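(* Let $\Phi\in\mathbb{R}^{\ell\times N}$ with $\ell<N$ satisfy the null space property of order $K$ for $\gamma\in(0,1)$, let $y\in\mathbb{R}^\ell$ be such that $\Phi^{-1}(y):=\{x\in\mathbb{R}^N \mid \Phi x=y\}$ is non-empty, let $\eta\in(0,1)$, and let $x^0\in\mathbb{R}^N$. If $\{x^n\}$ (with smoothing parameters $\{\epsilon_n\}$) is generated by the modified IRLS algorithm, described in the context, initialized at $x^0$, then there is an $\bar x\in\mathbb{R}^N$ such that $x^n\to\bar x$. Moreover, the following hold. (1) If $\epsilon:=\lim_{n\to\infty}\epsilon_n=0$, then $\bar x$ is $K$-sparse, in which case $\bar x$ is the unique minimizer of $\|x\|_1$ over $x\in\Phi^{-1}(y)$. (2) If there exists a $K$-sparse $x^*\in\Phi^{-1}(y)$, then $\bar x=x^*$ is the unique minimizer of $\|x\|_1$ over $x\in\Phi^{-1}(y)$, and $\lim_{n\to\infty}\epsilon_n=0$.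
   Context: Notation. For $x\in\mathbb{R}^N$, $r_i(x)$ is the $i$-th largest element (counted with multiplicity) of $|x_1|,\dots,|x_N|$, and $\sigma_j(x):=\sum_{\nu>j}r_\nu(x)$. A vector is $K$-sparse if it has at most $K$ non-zero components. For $S\subseteq\{1,\dots,N\}$, $x_S\in\mathbb{R}^N$ is the vector with $(x_S)_i=x_i$ for $i\in S$ and $(x_S)_i=0$ otherwise; $S^c$ is the complement of $S$ in $\{1,\dots,N\}$. For a positive weight vector $w\in\mathbb{R}^N$, $\|u\|_w:=\big(\sum_{i=1}^N w_iu_i^2\big)^{1/2}$. Null space property (NSP). $\Phi\in\mathbb{R}^{\ell\times N}$ satisfies the NSP of order $K$ (a positive integer) for $\gamma\in(0,1)$ if $\|z_T\|_1\le\gamma\|z_{T^c}\|_1$ for all $z\in\mathrm{Null}(\Phi)$ and all index sets $T\subset\{1,\dots,N\}$ of cardinality not exceeding $K$. Modified IRLS algorithm. The parameters $K,\gamma$ are those of the NSP, and $\eta\in(0,1)$ is fixed. Start with $x^0\in\mathbb{R}^N$ and $\epsilon_0=1$. For $n=0,1,2,\dots$: - set $w^n_i:=((x^n_i)^2+\epsilon_n^2)^{-1/2}$ for $i=1,\dots,N$; - set $x^{n+1}:=\operatorname{argmin}\{\|x\|_{w^n}^2 \mid x\in\Phi^{-1}(y)\}$; - set $\epsilon_{n+1}:=\min\left\{\epsilon_n,\ \frac{\eta(1-\gamma)\sigma_K(x^{n+1})}{N}\right\}$; - if $\epsilon_{n+1}=0$, stop with output $x^{n+1}$. If the algorithm stops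 with $\epsilon_{m}=0$, the sequences are understood to be continued by $x^n:=x^{m}$ and $\epsilon_n:=0$ for all $n\ge m$. *)

theory Defs
  imports "HOL-Analysis.Analysis" "HOL-Library.Multiset"
begin

definition l1_norm :: "real ^ 'n \<Rightarrow> real" where
  "l1_norm x = (\<Sum>i\<in>UNIV. \<bar>x $ i\<bar>)"

definition restrict_vec :: "real ^ 'n \<Rightarrow> 'n set \<Rightarrow> real ^ 'n" where
  "restrict_vec x S = (\<chi> i. if i \<in> S then x $ i else 0)"

definition k_sparse :: "nat \<Rightarrow> real ^ 'n \<Rightarrow> bool" where
  "k_sparse K x \<longleftrightarrow> card {i. x $ i \<noteq> 0} \<le> K"

text \<open>\<open>nth_largest x i\<close> is $r_i(x)$. The index \<open>i\<close> starts at 1 and is meaningful only up to the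
  dimension; \<open>mset_set UNIV\<close> keeps equal absolute values with their multiplicity.\<close>

definition nth_largest :: "real ^ 'n \<Rightarrow> nat \<Rightarrow> real" where
  "nth_largest x i =
     rev (sorted_list_of_multiset (image_mset (\<lambda>k. \<bar>x $ k\<bar>) (mset_set UNIV))) ! (i - 1)"

definition sigma_tail :: "nat \<Rightarrow> real ^ 'n \<Rightarrow> real" where
  "sigma_tail j x = (\<Sum>\<nu>\<in>{j<..CARD('n)}. nth_largest x \<nu>)"

definition weighted_norm :: "real ^ 'n \<Rightarrow> real ^ 'n \<Rightarrow> real" where
  "weighted_norm w u = sqrt (\<Sum>i\<in>UNIV. w $ i * (u $ i)\<^sup>2)"

definition null_space_property :: "real ^ 'n ^ 'l \<Rightarrow> nat \<Rightarrow> real \<Rightarrow> bool" where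
  "null_space_property \<Phi> K \<gamma> \<longleftrightarrow>
     (\<forall>z T. \<Phi> *v z = 0 \<longrightarrow> card T \<le> K \<longrightarrow>
        l1_norm (restrict_vec z T) \<le> \<gamma> * l1_norm (restrict_vec z (- T)))"

definition solutions :: "real ^ 'n ^ 'l \<Rightarrow> real ^ 'l \<Rightarrow> (real ^ 'n) set" where
  "solutions \<Phi> y = {x. \<Phi> *v x = y}"

definition is_unique_arg_min :: "('a \<Rightarrow> real) \<Rightarrow> ('a \<Rightarrow> bool) \<Rightarrow> 'a \<Rightarrow> bool" where
  "is_unique_arg_min f P x \<longleftrightarrow> is_arg_min f P x \<and> (\<forall>z. is_arg_min f P z \<longrightarrow> z = x)"

definition irls_weight :: "real ^ 'n \<Rightarrow> real \<Rightarrow> real ^ 'n" where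
  "irls_weight x \<epsilon> = (\<chi> i. ((x $ i)\<^sup>2 + \<epsilon>\<^sup>2) powr (- 1 / 2))"

text \<open>The branch \<open>eps n = 0\<close> is the constant continuation of the sequences after termination.
  In the other branch the weights are positive, so the weighted least squares problem has
  exactly one minimizer and the run is determined by \<open>x0\<close>.\<close>

definition modified_irls ::
  "real ^ 'n ^ 'l \<Rightarrow> real ^ 'l \<Rightarrow> nat \<Rightarrow> real \<Rightarrow> real \<Rightarrow> real ^ 'n \<Rightarrow>
   (nat \<Rightarrow> real ^ 'n) \<Rightarrow> (nat \<Rightarrow> real) \<Rightarrow> bool" where
  "modified_irls \<Phi> y K \<gamma> \<eta> x0 x eps \<longleftrightarrow>
     x 0 = x0 \<and> eps 0 = 1 \<and>
     (\<forall>n. if eps n = 0 then x (Suc n) = x n \<and> eps (Suc n) = 0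
          else
            is_arg_min (\<lambda>u. (weighted_norm (irls_weight (x n) (eps n)) u)\<^sup>2)
              (\<lambda>u. u \<in> solutions \<Phi> y) (x (Suc n)) \<and>
            eps (Suc n) =
              min (eps n) (\<eta> * (1 - \<gamma>) * sigma_tail K (x (Suc n)) / real CARD('n)))"

end

theory Submission imports Defs
begin

text \<open>The quantity \<open>\<Sum>i. sqrt ((x n $ i)\<^sup>2 + (eps n)\<^sup>2)\<close> decreases for \<open>n \<ge> 1\<close>, by at least a
  constant times the squared step. If \<open>eps\<close> tends to 0, then some cluster point has \<open>sigma_tail K = 0\<close>,
  hence is sparse; the quantity tends to its $\ell_1$ norm, and the null space property turns convergence of
  $\ell_1$ norms into convergence of the iterates. If \<open>eps\<close> tends to \<open>e > 0\<close>, the steps vanish, so every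
  cluster point is stationary for the strictly convex smoothed norm with parameter \<open>e\<close> on the
  solution set, which has only one stationary point. A sparse solution excludes this second case.\<close>

section \<open>Best approximation by sparse vectors\<close>

lemma l1_norm_restrict_vec: "l1_norm (restrict_vec z T) = (\<Sum>i\<in>T. \<bar>z $ i\<bar>)"
proof -
  have "l1_norm (restrict_vec z T) = (\<Sum>i\<in>UNIV. if i \<in> T then \<bar>z $ i\<bar> else 0)"
    by (auto simp: l1_norm_def restrict_vec_def intro: sum.cong)
  then show ?thesis
    by (simp add: sum.If_cases)
qed

lemma l1_norm_split: "l1_norm z = (\<Sum>i\<in>T. \<bar>z $ i\<bar>) + (\<Sum>i\<in>-T. \<bar>z $ i\<bar>)"
  unfolding l1_norm_def by (metis finite_class.finite_UNIV Compl_eq_Diff_UNIV add.commute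
      sum.subset_diff subset_UNIV)

lemma l1_norm_nonneg: "0 \<le> l1_norm z"
  by (simp add: l1_norm_def sum_nonneg)

lemma norm_le_l1_norm: "norm z \<le> l1_norm z"
  unfolding l1_norm_def by (rule norm_le_l1_cart)

lemma tendsto_l1_norm:
  assumes "(f \<longlongrightarrow> l) F"
  shows "((\<lambda>n. l1_norm (f n)) \<longlongrightarrow> l1_norm l) F"
  unfolding l1_norm_def by (intro tendsto_intros assms)

text \<open>Exchange argument: the maximum \<open>t\<close> of \<open>f\<close> on \<open>A\<close>
  separates the values on \<open>A - B\<close> from those on \<open>B - A\<close>, and
  \<open>B - A\<close> has at least as many elements.\<close>

lemma sum_smallest_le:
  fixes f :: "'a \<Rightarrow> real"
  assumes "finite A" "finite B" "card A \<le> card B"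
    and nonneg: "\<And>i. 0 \<le> f i"
    and le: "\<And>i j. i \<in> A \<Longrightarrow> j \<notin> A \<Longrightarrow> f i \<le> f j"
  shows "sum f A \<le> sum f B"
proof (cases "A = {}")
  case True
  then show ?thesis by (simp add: nonneg sum_nonneg)
next
  case False
  define t where "t = Max (f ` A)"
  have t: "t \<in> f ` A" and A: "\<And>i. i \<in> A \<Longrightarrow> f i \<le> t"
    using False assms(1) by (auto simp: t_def)
  have B: "\<And>j. j \<notin> A \<Longrightarrow> t \<le> f j" using t le by auto
  have "0 \<le> t" using t nonneg by auto
  have "card (A - B) \<le> card (B - A)"
    using assms by (simp add: card_le_sym_Diff)
  have "sum f (A - B) \<le> real (card (A - B)) * t"
    using A by (intro sum_bounded_above) auto
  also have "\<dots> \<le> real (card (B - A)) * t"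
    using \<open>card (A - B) \<le> card (B - A)\<close> \<open>0 \<le> t\<close> by (intro mult_right_mono) auto
  also have "\<dots> \<le> sum f (B - A)"
    using B by (intro sum_bounded_below) auto
  finally have "sum f (A - B) \<le> sum f (B - A)" .
  moreover have "sum f A = sum f (A \<inter> B) + sum f (A - B)"
    using assms(1) by (metis sum.Int_Diff)
  moreover have "sum f B = sum f (A \<inter> B) + sum f (B - A)"
    using assms(2) by (metis sum.Int_Diff Int_commute)
  ultimately show ?thesis by simp
qed

text \<open>Exhibits \<open>sigma_tail K x\<close> as the \<ell>1 distance of \<open>x\<close> to
  the \<open>K\<close>-sparse vectors, attained by keeping the largest entries. Later arguments use
  this variational form instead of sorted lists.\<close>

lemma sigma_tail_representation:
  fixes x :: "real ^ 'n"
  obtains T where "card T \<le> K" "sigma_tail K x = (\<Sum>i\<in>-T. \<bar>x $ i\<bar>)"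
    "\<And>T'. card T' \<le> K \<Longrightarrow> sigma_tail K x \<le> (\<Sum>i\<in>-T'. \<bar>x $ i\<bar>)"
proof -
  let ?N = "CARD('n)" and ?f = "\<lambda>k. \<bar>x $ k\<bar>"
  obtain zs :: "'n list" where zs: "set zs = UNIV" "distinct zs"
    using finite_distinct_list[OF finite_class.finite_UNIV] by blast
  define ys where "ys = sort_key ?f zs"
  have ys: "set ys = UNIV" "distinct ys" "sorted (map ?f ys)"
    using zs by (auto simp: ys_def)
  have len: "length ys = ?N" using ys by (metis distinct_card)
  have "mset ys = mset_set UNIV" using ys by (metis mset_set_set)
  then have list: "sorted_list_of_multiset (image_mset ?f (mset_set UNIV)) = map ?f ys"
    using ys by (metis mset_map sorted_list_of_multiset_mset sorted_sort_id)
  \<comment> \<open>\<open>?A\<close> collects the positions of the smallest entries. Truncated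
    subtraction makes it empty when \<open>K\<close> reaches the dimension.\<close>
  let ?A = "set (take (?N - K) ys)" and ?T = "set (drop (?N - K) ys)"
  have "?A \<union> ?T = UNIV" by (metis append_take_drop_id set_append ys(1))
  moreover have "?A \<inter> ?T = {}"
    by (rule set_take_disj_set_drop_if_distinct) (use ys in auto)
  ultimately have T: "- ?T = ?A" by blast
  have cA: "card ?A = ?N - K"
    using ys len by (subst distinct_card) auto
  have cT: "card ?T \<le> K"
    using len card_length[of "drop (?N - K) ys"] by simp
  \<comment> \<open>Ranks count from 1 in descending order, so rank \<nu> is position
    \<open>?N - \<nu>\<close>, counted from 0, of the ascending list.\<close>
  have "sigma_tail K x = (\<Sum>\<nu>\<in>{K<..?N}. ?f (ys ! (?N - \<nu>)))"
    unfolding sigma_tail_def nth_largest_def list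
    by (intro sum.cong) (auto simp: rev_nth len)
  also have "\<dots> = (\<Sum>j\<in>{..<?N - K}. ?f (ys ! j))"
    by (rule sum.reindex_bij_witness[where i = "\<lambda>j. ?N - j" and j = "\<lambda>j. ?N - j"]) auto
  also have "\<dots> = sum ?f ?A"
  proof -
    have "inj_on ((!) ys) {..<?N - K}"
      using ys len by (intro inj_on_nth) auto
    moreover have "(!) ys ` {..<?N - K} = ?A"
      using len nth_image[of "?N - K" ys] by (simp add: atLeast0LessThan)
    ultimately show ?thesis
      by (metis (no_types, lifting) sum.reindex_cong)
  qed
  finally have sig: "sigma_tail K x = sum ?f ?A" .
  have le: "?f i \<le> ?f j" if ij: "i \<in> ?A" "j \<notin> ?A" for i j
  proof -
    have "sorted (map ?f (take (?N - K) ys) @ map ?f (drop (?N - K) ys))"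
      using ys(3) by (metis append_take_drop_id map_append)
    moreover have "j \<in> ?T" using T ij by blast
    ultimately show ?thesis using ij by (auto simp: sorted_append)
  qed
  have "sigma_tail K x \<le> (\<Sum>i\<in>-T'. ?f i)" if "card T' \<le> K" for T'
    unfolding sig using that cA le
    by (intro sum_smallest_le) (auto simp: Compl_eq_Diff_UNIV card_Diff_subset)
  with that[of ?T] cT sig T show ?thesis by simp
qed

lemma sigma_tail_le:
  fixes x :: "real ^ 'n"
  assumes "card T \<le> K"
  shows "sigma_tail K x \<le> (\<Sum>i\<in>-T. \<bar>x $ i\<bar>)"
  using assms sigma_tail_representation by metis

lemma sigma_tail_nonneg:
  fixes x :: "real ^ 'n"
  shows "0 \<le> sigma_tail K x"
  using sigma_tail_representation[of K x] by (metis abs_ge_zero sum_nonneg)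

lemma sigma_tail_le_zero_imp_k_sparse:
  fixes x :: "real ^ 'n"
  assumes "sigma_tail K x \<le> 0"
  shows "k_sparse K x"
proof -
  obtain T where T: "card T \<le> K" "sigma_tail K x = (\<Sum>i\<in>-T. \<bar>x $ i\<bar>)"
    using sigma_tail_representation[of K x] by metis
  then have "(\<Sum>i\<in>-T. \<bar>x $ i\<bar>) = 0"
    using assms by (metis abs_ge_zero order_antisym sum_nonneg)
  then have "\<forall>i\<in>-T. x $ i = 0"
    by (simp add: sum_nonneg_eq_0_iff)
  then have "{i. x $ i \<noteq> 0} \<subseteq> T" by blast
  then show ?thesis
    unfolding k_sparse_def using T(1) card_mono[of T] by (meson finite_class.finite le_trans)
qed

text \<open>The optimal index set for \<open>z\<close> is a competitor for \<open>x\<close>.\<close>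

lemma sigma_tail_lipschitz:
  fixes x z :: "real ^ 'n"
  shows "sigma_tail K x \<le> sigma_tail K z + l1_norm (x - z)"
proof -
  obtain T where T: "card T \<le> K" "sigma_tail K z = (\<Sum>i\<in>-T. \<bar>z $ i\<bar>)"
    using sigma_tail_representation[of K z] by metis
  have "sigma_tail K x \<le> (\<Sum>i\<in>-T. \<bar>x $ i\<bar>)" using T by (simp add: sigma_tail_le)
  also have "\<dots> \<le> (\<Sum>i\<in>-T. \<bar>z $ i\<bar> + \<bar>(x - z) $ i\<bar>)" by (intro sum_mono) auto
  also have "\<dots> = sigma_tail K z + (\<Sum>i\<in>-T. \<bar>(x - z) $ i\<bar>)" by (simp add: T sum.distrib)
  also have "(\<Sum>i\<in>-T. \<bar>(x - z) $ i\<bar>) \<le> l1_norm (x - z)"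
    unfolding l1_norm_def by (intro sum_mono2) auto
  finally show ?thesis by simp
qed

text \<open>Lower semicontinuity suffices to show that a limit of vectors whose tails tend to 0 is
  sparse.\<close>

lemma tendsto_sigma_tail_le:
  fixes z :: "nat \<Rightarrow> real ^ 'n"
  assumes "z \<longlonglongrightarrow> l" "(\<lambda>n. sigma_tail K (z n)) \<longlonglongrightarrow> s"
  shows "sigma_tail K l \<le> s"
proof -
  have "(\<lambda>n. l - z n) \<longlonglongrightarrow> l - l" by (intro tendsto_intros assms)
  from tendsto_add[OF assms(2) tendsto_l1_norm[OF this]]
  have "(\<lambda>n. sigma_tail K (z n) + l1_norm (l - z n)) \<longlonglongrightarrow> s"
    by (simp add: l1_norm_def)
  then show ?thesis
    by (rule LIMSEQ_le_const) (auto intro: sigma_tail_lipschitz)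
qed

section \<open>The null space property\<close>

text \<open>Off \<open>T\<close> the kernel vector \<open>u - v\<close> agrees with
  \<open>u\<close>, so its mass on \<open>T\<close> is at most \<gamma> times the tail of
  \<open>u\<close>. The triangle inequality on \<open>T\<close> then gives the first bound, and
  adding the two parts of \<open>u - v\<close> the second.\<close>

lemma null_space_property_gap:
  assumes nsp: "null_space_property \<Phi> K \<gamma>" and "u \<in> solutions \<Phi> y" "v \<in> solutions \<Phi> y"
    and T: "card T \<le> K" "\<And>i. i \<notin> T \<Longrightarrow> v $ i = 0"
  shows "(1 - \<gamma>) * (\<Sum>i\<in>-T. \<bar>u $ i\<bar>) \<le> l1_norm u - l1_norm v"
    and "l1_norm (u - v) \<le> (1 + \<gamma>) * (\<Sum>i\<in>-T. \<bar>u $ i\<bar>)"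
proof -
  let ?z = "u - v"
  have "\<Phi> *v ?z = 0"
    using assms(2,3) by (simp add: solutions_def matrix_vector_mult_diff_distrib)
  then have n: "(\<Sum>i\<in>T. \<bar>?z $ i\<bar>) \<le> \<gamma> * (\<Sum>i\<in>-T. \<bar>?z $ i\<bar>)"
    using nsp T(1) unfolding null_space_property_def l1_norm_restrict_vec by blast
  have c: "(\<Sum>i\<in>-T. \<bar>?z $ i\<bar>) = (\<Sum>i\<in>-T. \<bar>u $ i\<bar>)"
    using T(2) by (intro sum.cong) auto
  have v: "(\<Sum>i\<in>-T. \<bar>v $ i\<bar>) = 0" using T(2) by simp
  have "(\<Sum>i\<in>T. \<bar>v $ i\<bar>) \<le> (\<Sum>i\<in>T. \<bar>u $ i\<bar> + \<bar>?z $ i\<bar>)" by (intro sum_mono) auto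
  then have "(\<Sum>i\<in>T. \<bar>v $ i\<bar>) \<le> (\<Sum>i\<in>T. \<bar>u $ i\<bar>) + (\<Sum>i\<in>T. \<bar>?z $ i\<bar>)"
    by (simp only: sum.distrib)
  then show "(1 - \<gamma>) * (\<Sum>i\<in>-T. \<bar>u $ i\<bar>) \<le> l1_norm u - l1_norm v"
    using n c v l1_norm_split[of u T] l1_norm_split[of v T] by (simp only: algebra_simps)
  show "l1_norm ?z \<le> (1 + \<gamma>) * (\<Sum>i\<in>-T. \<bar>u $ i\<bar>)"
    using n c l1_norm_split[of ?z T] by (simp only: algebra_simps)
qed

text \<open>Eliminates the tail of \<open>u\<close> between the two bounds of
  \<open>null_space_property_gap\<close>: excess \<ell>1 norm over a sparse solution controls the
  distance to it.\<close>

lemma null_space_property_l1_dist: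
  assumes "null_space_property \<Phi> K \<gamma>" "0 < \<gamma>" "\<gamma> < 1"
    and "u \<in> solutions \<Phi> y" "v \<in> solutions \<Phi> y" "k_sparse K v"
  shows "(1 - \<gamma>) * l1_norm (u - v) \<le> (1 + \<gamma>) * (l1_norm u - l1_norm v)"
proof -
  let ?T = "{i. v $ i \<noteq> 0}"
  have T: "card ?T \<le> K" "\<And>i. i \<notin> ?T \<Longrightarrow> v $ i = 0"
    using assms(6) by (auto simp: k_sparse_def)
  note gap = null_space_property_gap[OF assms(1,4,5) T]
  have "(1 - \<gamma>) * l1_norm (u - v) \<le> (1 - \<gamma>) * ((1 + \<gamma>) * (\<Sum>i\<in>-?T. \<bar>u $ i\<bar>))"
    using gap(2) assms by (intro mult_left_mono) auto
  also have "\<dots> = (1 + \<gamma>) * ((1 - \<gamma>) * (\<Sum>i\<in>-?T. \<bar>u $ i\<bar>))" by simp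
  also have "\<dots> \<le> (1 + \<gamma>) * (l1_norm u - l1_norm v)"
    using gap(1) assms by (intro mult_left_mono) auto
  finally show ?thesis .
qed

lemma null_space_property_unique_arg_min:
  assumes "null_space_property \<Phi> K \<gamma>" "0 < \<gamma>" "\<gamma> < 1" "v \<in> solutions \<Phi> y" "k_sparse K v"
  shows "is_unique_arg_min l1_norm (\<lambda>u. u \<in> solutions \<Phi> y) v"
proof -
  have less: "l1_norm v < l1_norm u" if "u \<in> solutions \<Phi> y" "u \<noteq> v" for u
  proof -
    have "0 < norm (u - v)" using that by simp
    then have "0 < l1_norm (u - v)"
      using norm_le_l1_norm by (rule less_le_trans)
    then have "0 < (1 - \<gamma>) * l1_norm (u - v)"
      using assms(3) by simp
    then have "0 < (1 + \<gamma>) * (l1_norm u - l1_norm v)"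
      using null_space_property_l1_dist[OF assms(1-3) that(1) assms(4,5)] by linarith
    then show ?thesis using assms(2) by (simp add: zero_less_mult_iff)
  qed
  then have "\<not> l1_norm u < l1_norm v" if "u \<in> solutions \<Phi> y" for u
    using that by (metis less_asym)
  with less assms(4) show ?thesis
    unfolding is_unique_arg_min_def is_arg_min_def by metis
qed

section \<open>The smoothed norm\<close>

text \<open>The \<ell>1 norm with its corners rounded at scale \<open>e\<close>. For nonzero
  \<open>e\<close> its partial derivatives are \<open>irls_weight x e $ i * x $ i\<close>, which
  ties it to the weighted least squares problems.\<close>

definition smooth_l1 :: "real \<Rightarrow> real ^ 'n \<Rightarrow> real" where
  "smooth_l1 e x = (\<Sum>i\<in>UNIV. sqrt ((x $ i)\<^sup>2 + e\<^sup>2))"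

lemma l1_norm_le_smooth_l1: "l1_norm x \<le> smooth_l1 e x"
  unfolding l1_norm_def smooth_l1_def by (intro sum_mono) (simp add: real_le_rsqrt)

lemma smooth_l1_le_l1_norm:
  fixes x :: "real ^ 'n"
  assumes "0 \<le> e"
  shows "smooth_l1 e x \<le> l1_norm x + real CARD('n) * e"
proof -
  have "sqrt ((x $ i)\<^sup>2 + e\<^sup>2) \<le> \<bar>x $ i\<bar> + e" for i
    using sqrt_sum_squares_le_sum_abs[of "x $ i" e] assms by simp
  then have "smooth_l1 e x \<le> (\<Sum>i\<in>UNIV. \<bar>x $ i\<bar> + e)"
    unfolding smooth_l1_def by (intro sum_mono) auto
  then show ?thesis by (simp add: l1_norm_def sum.distrib)
qed

lemma smooth_l1_mono: "0 \<le> d \<Longrightarrow> d \<le> e \<Longrightarrow> smooth_l1 d x \<le> smooth_l1 e x"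
  unfolding smooth_l1_def by (intro sum_mono) (simp add: power_mono)

lemma sqrt_le_smooth_l1: "sqrt ((x $ i)\<^sup>2 + e\<^sup>2) \<le> smooth_l1 e x"
  unfolding smooth_l1_def by (rule member_le_sum) auto

lemma tendsto_smooth_l1:
  assumes "(f \<longlongrightarrow> l) F" "(e \<longlongrightarrow> d) F"
  shows "((\<lambda>n. smooth_l1 (e n) (f n)) \<longlongrightarrow> smooth_l1 d l) F"
  unfolding smooth_l1_def by (intro tendsto_intros assms)

lemma irls_weight_nth: "irls_weight x e $ i = 1 / sqrt ((x $ i)\<^sup>2 + e\<^sup>2)"
  by (simp add: irls_weight_def powr_minus_divide powr_half_sqrt)

text \<open>Concavity of the square root; the gap to the tangent at \<open>b\<close> is an explicit
  square over \<open>2 * sqrt b\<close>.\<close>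

lemma sqrt_le_tangent:
  fixes a b :: real
  assumes "0 < b" "0 \<le> a"
  shows "sqrt a \<le> sqrt b + (a - b) / (2 * sqrt b)"
proof -
  have "sqrt b + (a - b) / (2 * sqrt b) - sqrt a = (sqrt a - sqrt b)\<^sup>2 / (2 * sqrt b)"
    using assms by (simp add: field_simps power2_eq_square)
  moreover have "0 \<le> (sqrt a - sqrt b)\<^sup>2 / (2 * sqrt b)" using assms by simp
  ultimately show ?thesis by linarith
qed

text \<open>Strict convexity of the rounded absolute value. Cleared of denominators it is the
  Cauchy-Schwarz inequality for \<open>(e, v)\<close> and \<open>(e, u)\<close>, whose defect is
  \<open>e\<^sup>2 * (u - v)\<^sup>2\<close>.\<close>

lemma smoothed_abs_tangent:
  fixes u v e :: real
  assumes "e \<noteq> 0" "u \<noteq> v"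
  shows "sqrt (v\<^sup>2 + e\<^sup>2) + v * (u - v) / sqrt (v\<^sup>2 + e\<^sup>2) < sqrt (u\<^sup>2 + e\<^sup>2)"
proof -
  let ?s = "sqrt (v\<^sup>2 + e\<^sup>2)" and ?t = "sqrt (u\<^sup>2 + e\<^sup>2)"
  have s: "0 < ?s" "?s * ?s = v\<^sup>2 + e\<^sup>2" using assms(1) by (auto simp: sum_power2_gt_zero_iff)
  have "0 < e\<^sup>2 * (u - v)\<^sup>2" using assms by simp
  then have "(e\<^sup>2 + v * u)\<^sup>2 < (v\<^sup>2 + e\<^sup>2) * (u\<^sup>2 + e\<^sup>2)"
    by (simp add: power2_eq_square algebra_simps)
  then have "e\<^sup>2 + v * u < ?s * ?t" by (metis real_less_rsqrt real_sqrt_mult)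
  then have "(v\<^sup>2 + e\<^sup>2 + v * (u - v)) / ?s < ?t"
    using s(1) by (simp add: field_simps power2_eq_square)
  moreover have "(v\<^sup>2 + e\<^sup>2) / ?s = ?s" by (rule real_div_sqrt) simp
  ultimately show ?thesis by (simp add: add_divide_distrib)
qed

text \<open>The assumed sum is the directional derivative at \<open>v\<close> towards
  \<open>u\<close>. Tangent inequalities are summed, with strictness from one coordinate where the
  vectors differ.\<close>

lemma smooth_l1_less_of_stationary:
  fixes u v :: "real ^ 'n"
  assumes "e \<noteq> 0" "u \<noteq> v"
    and "(\<Sum>i\<in>UNIV. v $ i * (u - v) $ i / sqrt ((v $ i)\<^sup>2 + e\<^sup>2)) = 0"
  shows "smooth_l1 e v < smooth_l1 e u"
proof -
  let ?g = "\<lambda>i. sqrt ((v $ i)\<^sup>2 + e\<^sup>2) + v $ i * (u - v) $ i / sqrt ((v $ i)\<^sup>2 + e\<^sup>2)"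
  obtain j where j: "u $ j \<noteq> v $ j" using assms(2) by (auto simp: vec_eq_iff)
  have "smooth_l1 e v = sum ?g UNIV"
    using assms(3) by (simp add: smooth_l1_def sum.distrib)
  also have "\<dots> < smooth_l1 e u"
    unfolding smooth_l1_def
  proof (rule sum_strict_mono_ex1)
    show "\<forall>i\<in>UNIV. ?g i \<le> sqrt ((u $ i)\<^sup>2 + e\<^sup>2)"
    proof
      fix i show "?g i \<le> sqrt ((u $ i)\<^sup>2 + e\<^sup>2)"
        using smoothed_abs_tangent[OF assms(1), of "u $ i" "v $ i"]
        by (cases "u $ i = v $ i") auto
    qed
    show "\<exists>i\<in>UNIV. ?g i < sqrt ((u $ i)\<^sup>2 + e\<^sup>2)"
      using smoothed_abs_tangent[OF assms(1) j] by auto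
  qed simp
  finally show ?thesis .
qed

lemma linear_coefficient_eq_zero:
  fixes b c :: real
  assumes "\<And>t. 0 \<le> 2 * t * b + t\<^sup>2 * c" "0 \<le> c"
  shows "b = 0"
proof (rule ccontr)
  assume "b \<noteq> 0"
  \<comment> \<open>The denominator \<open>c + 1\<close> stays positive even for
    \<open>c = 0\<close>, and the quadratic is still negative at this point.\<close>
  have "2 * (- b / (c + 1)) * b + (- b / (c + 1))\<^sup>2 * c = - (b\<^sup>2 * (c + 2) / (c + 1)\<^sup>2)"
    using assms(2) by (simp add: power2_eq_square divide_simps) (simp add: algebra_simps)
  moreover have "0 < b\<^sup>2 * (c + 2) / (c + 1)\<^sup>2"
    using \<open>b \<noteq> 0\<close> assms(2) by (intro divide_pos_pos mult_pos_pos) auto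
  ultimately show False using assms(1)[of "- b / (c + 1)"] by linarith
qed

text \<open>First-order optimality: the line \<open>v + t *\<^sub>R z\<close> stays feasible, and
  along it the objective is a quadratic in \<open>t\<close> with slope \<open>2 * ?b\<close> at its
  minimum \<open>t = 0\<close>.\<close>

lemma weighted_norm_arg_min_orthogonal:
  assumes w: "\<And>i. 0 \<le> w $ i"
    and min: "is_arg_min (\<lambda>u. (weighted_norm w u)\<^sup>2) (\<lambda>u. u \<in> solutions \<Phi> y) v"
    and z: "\<Phi> *v z = 0"
  shows "(\<Sum>i\<in>UNIV. w $ i * (v $ i * z $ i)) = 0"
proof (rule ccontr)
  let ?b = "\<Sum>i\<in>UNIV. w $ i * (v $ i * z $ i)"
  let ?c = "\<Sum>i\<in>UNIV. w $ i * (z $ i)\<^sup>2"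
  assume b: "?b \<noteq> 0"
  have sq: "(weighted_norm w u)\<^sup>2 = (\<Sum>i\<in>UNIV. w $ i * (u $ i)\<^sup>2)" for u
    using w by (simp add: weighted_norm_def sum_nonneg)
  have c: "0 \<le> ?c" using w by (simp add: sum_nonneg)
  have "0 \<le> 2 * t * ?b + t\<^sup>2 * ?c" for t
  proof -
    have "v + t *\<^sub>R z \<in> solutions \<Phi> y"
      using min z unfolding is_arg_min_def solutions_def
      by (simp add: matrix_vector_right_distrib matrix_vector_mult_scaleR)
    then have "(\<Sum>i\<in>UNIV. w $ i * (v $ i)\<^sup>2) \<le> (\<Sum>i\<in>UNIV. w $ i * ((v + t *\<^sub>R z) $ i)\<^sup>2)"
      using min unfolding is_arg_min_def sq by (metis not_less)
    also have "\<dots> = (\<Sum>i\<in>UNIV. w $ i * (v $ i)\<^sup>2 + 2 * t * (w $ i * (v $ i * z $ i)) + t\<^sup>2 * (w $ i * (z $ i)\<^sup>2))"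
      by (intro sum.cong) (auto simp: power2_eq_square algebra_simps)
    finally show ?thesis by (simp add: sum.distrib sum_distrib_left)
  qed
  then have "?b = 0" using c by (rule linear_coefficient_eq_zero)
  with b show False by simp
qed

text \<open>The tangent of the square root majorizes \<open>smooth_l1 e\<close> by a weighted least squares functional,
  and the gain is quadratic because the minimizer is orthogonal to the null space.\<close>

lemma smooth_l1_decrease:
  fixes v x :: "real ^ 'n"
  assumes e: "e \<noteq> 0"
    and min: "is_arg_min (\<lambda>u. (weighted_norm (irls_weight x e) u)\<^sup>2) (\<lambda>u. u \<in> solutions \<Phi> y) v"
    and x: "x \<in> solutions \<Phi> y"
  shows "smooth_l1 e v + (norm (v - x))\<^sup>2 / (2 * smooth_l1 e x) \<le> smooth_l1 e x"
proof -
  let ?s = "\<lambda>i. sqrt ((x $ i)\<^sup>2 + e\<^sup>2)"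
  have s: "0 < ?s i" for i using e by (simp add: sum_power2_gt_zero_iff)
  have "v \<in> solutions \<Phi> y" using min by (simp add: is_arg_min_def)
  then have "\<Phi> *v (v - x) = 0"
    using x by (simp add: solutions_def matrix_vector_mult_diff_distrib)
  with min have orth: "(\<Sum>i\<in>UNIV. (1 / ?s i) * (v $ i * (v - x) $ i)) = 0"
    using weighted_norm_arg_min_orthogonal[of "irls_weight x e" \<Phi> y v "v - x"]
    by (simp add: irls_weight_nth)
  \<comment> \<open>Splits the tangent term into a part that sums to zero by \<open>orth\<close> and
    a negative square, the source of the gain.\<close>
  have square: "(a\<^sup>2 - b\<^sup>2) / (2 * t) = (1 / t) * (a * (a - b)) - (a - b)\<^sup>2 / (2 * t)"
    if "0 < t" for a b t :: real
    using that by (simp add: field_simps power2_eq_square)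
  have step: "sqrt ((v $ i)\<^sup>2 + e\<^sup>2) + ((v - x) $ i)\<^sup>2 / (2 * smooth_l1 e x)
      \<le> ?s i + (1 / ?s i) * (v $ i * (v - x) $ i)" for i
  proof -
    have "sqrt ((v $ i)\<^sup>2 + e\<^sup>2) \<le> ?s i + ((v $ i)\<^sup>2 - (x $ i)\<^sup>2) / (2 * ?s i)"
      using sqrt_le_tangent[of "(x $ i)\<^sup>2 + e\<^sup>2" "(v $ i)\<^sup>2 + e\<^sup>2"] s[of i] by simp
    also have "\<dots> = ?s i + (1 / ?s i) * (v $ i * (v - x) $ i) - ((v - x) $ i)\<^sup>2 / (2 * ?s i)"
      using square[OF s[of i], of "v $ i" "x $ i"] by simp
    finally have "sqrt ((v $ i)\<^sup>2 + e\<^sup>2) + ((v - x) $ i)\<^sup>2 / (2 * ?s i)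
        \<le> ?s i + (1 / ?s i) * (v $ i * (v - x) $ i)" by simp
    \<comment> \<open>One common denominator for all coordinates lets the gains add up to the
      squared Euclidean norm.\<close>
    moreover have "((v - x) $ i)\<^sup>2 / (2 * ?s i) \<ge> ((v - x) $ i)\<^sup>2 / (2 * smooth_l1 e x)"
      using s[of i] sqrt_le_smooth_l1[of x i e] by (intro frac_le) auto
    ultimately show ?thesis by linarith
  qed
  have "(norm (v - x))\<^sup>2 = (\<Sum>i\<in>UNIV. ((v - x) $ i)\<^sup>2)"
    by (simp add: norm_vec_def L2_set_def sum_nonneg)
  then have "smooth_l1 e v + (norm (v - x))\<^sup>2 / (2 * smooth_l1 e x)
      = (\<Sum>i\<in>UNIV. sqrt ((v $ i)\<^sup>2 + e\<^sup>2) + ((v - x) $ i)\<^sup>2 / (2 * smooth_l1 e x))"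
    by (simp add: smooth_l1_def[of e v] sum.distrib sum_divide_distrib)
  also have "\<dots> \<le> (\<Sum>i\<in>UNIV. ?s i + (1 / ?s i) * (v $ i * (v - x) $ i))"
    by (intro sum_mono step)
  also have "\<dots> = smooth_l1 e x"
    using orth by (simp only: sum.distrib smooth_l1_def)
  finally show ?thesis .
qed

section \<open>Convergence\<close>

lemma tendsto_if_unique_cluster_point:
  fixes x :: "nat \<Rightarrow> 'a :: heine_borel"
  assumes "bounded (range x)"
    and unique: "\<And>r l. strict_mono r \<Longrightarrow> (x \<circ> r) \<longlonglongrightarrow> l \<Longrightarrow> l = L"
  shows "x \<longlonglongrightarrow> L"
proof (rule ccontr)
  assume "\<not> x \<longlonglongrightarrow> L"
  then obtain e where "0 < e" and "\<exists>\<^sub>F n in sequentially. \<not> dist (x n) L < e"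
    unfolding tendsto_iff frequently_def by auto
  then have inf: "infinite {n. \<not> dist (x n) L < e}"
    by (simp add: frequently_cofinite cofinite_eq_sequentially[symmetric])
  \<comment> \<open>The indices staying away from \<open>L\<close> form a subsequence; by
    compactness it has a cluster point, which cannot be \<open>L\<close>.\<close>
  define r where "r = enumerate {n. \<not> dist (x n) L < e}"
  have r: "strict_mono r" "\<And>n. e \<le> dist (x (r n)) L"
    using inf enumerate_in_set[OF inf] by (auto simp: r_def strict_mono_enumerate not_less)
  have "bounded (range (x \<circ> r))"
    using assms(1) by (rule bounded_subset) auto
  then obtain l q where q: "strict_mono q" "(x \<circ> r \<circ> q) \<longlonglongrightarrow> l"
    using bounded_imp_convergent_subsequence by blast
  then have "l = L"
    using unique[of "r \<circ> q" l] r(1) by (simp add: strict_mono_o o_assoc)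
  with q(2) \<open>0 < e\<close> have "\<forall>\<^sub>F n in sequentially. dist (x (r (q n))) L < e"
    unfolding tendsto_iff by (simp add: o_def)
  then obtain n where "dist (x (r (q n))) L < e"
    using eventually_happens by force
  with r(2)[of "q n"] show False by simp
qed

locale irls =
  fixes \<Phi> :: "real ^ 'n ^ 'l" and y :: "real ^ 'l"
    and K :: nat and \<gamma> \<eta> :: real
    and x0 :: "real ^ 'n" and x :: "nat \<Rightarrow> real ^ 'n" and eps :: "nat \<Rightarrow> real"
  assumes gamma: "0 < \<gamma>" "\<gamma> < 1"
    and nsp: "null_space_property \<Phi> K \<gamma>"
    and eta: "0 < \<eta>" "\<eta> < 1"
    and run: "modified_irls \<Phi> y K \<gamma> \<eta> x0 x eps"
begin

section \<open>Invariants and monotone quantities of a run\<close>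

lemma eps_0: "eps 0 = 1"
  using run by (simp add: modified_irls_def)

lemma stopped:
  assumes "eps n = 0"
  shows "x (Suc n) = x n" "eps (Suc n) = 0"
  using run assms unfolding modified_irls_def by metis+

lemma step_arg_min:
  assumes "eps n \<noteq> 0"
  shows "is_arg_min (\<lambda>u. (weighted_norm (irls_weight (x n) (eps n)) u)\<^sup>2)
    (\<lambda>u. u \<in> solutions \<Phi> y) (x (Suc n))"
  using run assms unfolding modified_irls_def by metis

lemma step_eps:
  assumes "eps n \<noteq> 0"
  shows "eps (Suc n) = min (eps n) (\<eta> * (1 - \<gamma>) * sigma_tail K (x (Suc n)) / real CARD('n))"
  using run assms unfolding modified_irls_def by metis

lemma eps_nonneg: "0 \<le> eps n"
proof (induction n)
  case (Suc n)
  then show ?case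
    using stopped(2)[of n] step_eps[of n] gamma eta sigma_tail_nonneg[of K "x (Suc n)"]
    by (cases "eps n = 0") auto
qed (simp add: eps_0)

lemma eps_decseq: "decseq eps"
  unfolding decseq_Suc_iff
proof
  fix n show "eps (Suc n) \<le> eps n"
    using stopped(2)[of n] step_eps[of n] by (cases "eps n = 0") auto
qed

lemma eps_le_sigma_tail: "eps (Suc n) \<le> \<eta> * (1 - \<gamma>) * sigma_tail K (x (Suc n)) / real CARD('n)"
  using stopped(2)[of n] step_eps[of n] gamma eta sigma_tail_nonneg[of K "x (Suc n)"]
  by (cases "eps n = 0") auto

lemma x_solution: "x (Suc n) \<in> solutions \<Phi> y"
proof (induction n)
  case 0
  then show ?case using step_arg_min[of 0] by (simp add: eps_0 is_arg_min_def)
next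
  case (Suc n)
  then show ?case
    using stopped(1)[of "Suc n"] step_arg_min[of "Suc n"]
    by (cases "eps (Suc n) = 0") (auto simp: is_arg_min_def)
qed

text \<open>The index is shifted because \<open>x 0\<close> need not be a solution.\<close>

definition "F n = smooth_l1 (eps (Suc n)) (x (Suc n))"

text \<open>Two decreases combine: the least squares step at fixed smoothing gives the quadratic
  gain, and lowering the smoothing parameter only helps.\<close>

lemma F_decrease:
  assumes "eps (Suc n) \<noteq> 0"
  shows "F (Suc n) + (norm (x (Suc (Suc n)) - x (Suc n)))\<^sup>2 / (2 * F n) \<le> F n"
proof -
  have "F (Suc n) \<le> smooth_l1 (eps (Suc n)) (x (Suc (Suc n)))"
    unfolding F_def using eps_decseq eps_nonneg by (intro smooth_l1_mono) (auto simp: decseq_Suc_iff)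
  then show ?thesis
    using smooth_l1_decrease[OF assms step_arg_min[OF assms] x_solution] unfolding F_def by linarith
qed

lemma F_nonneg: "0 \<le> F n"
  using l1_norm_nonneg l1_norm_le_smooth_l1 unfolding F_def by (rule order_trans)

lemma F_decseq: "decseq F"
  unfolding decseq_Suc_iff
proof
  fix n show "F (Suc n) \<le> F n"
  proof (cases "eps (Suc n) = 0")
    case True
    then show ?thesis using stopped[OF True] by (simp add: F_def)
  next
    case False
    then show ?thesis
      using F_decrease[of n] F_nonneg[of n] by (smt (verit) divide_nonneg_nonneg zero_le_power2)
  qed
qed

lemma F_convergent: "convergent F"
  using decseq_convergent[OF F_decseq] F_nonneg by (metis convergentI)

lemma x_bounded: "bounded (range (\<lambda>n. x (Suc n)))"
proof -
  have "norm (x (Suc n)) \<le> F 0" for n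
  proof -
    have "norm (x (Suc n)) \<le> F n"
      unfolding F_def using norm_le_l1_norm l1_norm_le_smooth_l1 by (rule order_trans)
    also have "\<dots> \<le> F 0" using F_decseq by (simp add: decseq_def)
    finally show ?thesis .
  qed
  then show ?thesis by (auto simp: bounded_iff)
qed

lemma solutions_closed: "closed (solutions \<Phi> y)"
proof -
  have "continuous_on UNIV (\<lambda>u. \<Phi> *v u)" by (intro continuous_intros)
  then show ?thesis
    unfolding solutions_def by (intro closed_Collect_eq) (auto intro: continuous_intros)
qed

section \<open>Smoothing parameter tending to zero\<close>

lemma stopped_sigma_tail:
  "eps (Suc n) = 0 \<Longrightarrow> sigma_tail K (x (Suc n)) = 0"
proof (induction n)
  case 0
  \<comment> \<open>Since \<open>eps 0 = 1\<close>, a zero value can only come from the tail term of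
    the minimum.\<close>
  then show ?case using step_eps[of 0] gamma eta by (auto simp: eps_0 min_def split: if_splits)
next
  case (Suc n)
  then show ?case
    using stopped(1)[of "Suc n"] step_eps[of "Suc n"] gamma eta
    by (cases "eps (Suc n) = 0") (auto simp: min_def split: if_splits)
qed

text \<open>The minimum in the update may keep an old value, so tails are controlled only at indices
  where the tail term is attained. Along these they are proportional to \<open>eps\<close> and tend
  to 0.\<close>

lemma sparse_cluster_point:
  assumes "eps \<longlonglongrightarrow> 0"
  obtains r l where "strict_mono r" "(\<lambda>n. x (Suc (r n))) \<longlonglongrightarrow> l" "k_sparse K l"
    "l \<in> solutions \<Phi> y"
proof -
  define c where "c = \<eta> * (1 - \<gamma>) / real CARD('n)"
  have c: "0 < c" using gamma eta by (simp add: c_def)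
  \<comment> \<open>After termination both sides are 0, so \<open>A\<close> also contains all those
    indices.\<close>
  define A where "A = {n. eps (Suc n) = c * sigma_tail K (x (Suc n))}"
  have stay: "eps (Suc n) = eps n \<and> eps (Suc n) \<noteq> 0" if "n \<notin> A" for n
  proof -
    have "eps (Suc n) \<noteq> 0" using that stopped_sigma_tail[of n] by (auto simp: A_def)
    then have "eps n \<noteq> 0" using stopped(2) by blast
    with step_eps[of n] that \<open>eps (Suc n) \<noteq> 0\<close> show ?thesis
      by (auto simp: A_def c_def min_def split: if_splits)
  qed
  \<comment> \<open>If \<open>A\<close> were finite, \<open>eps\<close> would eventually be frozen
    at a nonzero value.\<close>
  have inf: "infinite A"
  proof
    assume "finite A"
    then obtain m where m: "\<And>n. m \<le> n \<Longrightarrow> n \<notin> A"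
      by (metis finite_nat_set_iff_bounded not_less)
    have "eps (n + m) = eps m" for n
      by (induction n) (use stay m in auto)
    then have "eps m = 0"
      using LIMSEQ_ignore_initial_segment[OF assms, of m] by (simp add: LIMSEQ_const_iff)
    then show False using stay[OF m[of m]] by simp
  qed
  define s where "s = enumerate A"
  have s: "strict_mono s" "\<And>n. s n \<in> A"
    using inf enumerate_in_set[OF inf] by (auto simp: s_def strict_mono_enumerate)
  have "bounded (range (\<lambda>n. x (Suc (s n))))"
    using x_bounded by (rule bounded_subset) auto
  then obtain l q where q: "strict_mono q" "((\<lambda>n. x (Suc (s n))) \<circ> q) \<longlonglongrightarrow> l"
    using bounded_imp_convergent_subsequence by blast
  define r where "r = s \<circ> q"
  have r: "strict_mono r" "(\<lambda>n. x (Suc (r n))) \<longlonglongrightarrow> l" "\<And>n. r n \<in> A"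
    using s q by (auto simp: r_def o_def strict_mono_o intro: strict_mono_o[unfolded o_def])
  have "(\<lambda>n. eps (Suc (r n)) / c) \<longlonglongrightarrow> 0 / c"
    using LIMSEQ_subseq_LIMSEQ[OF LIMSEQ_Suc[OF assms] r(1)] c
    by (intro tendsto_intros) (auto simp: o_def)
  moreover have "eps (Suc (r n)) / c = sigma_tail K (x (Suc (r n)))" for n
    using r(3)[of n] c by (simp add: A_def)
  ultimately have "sigma_tail K l \<le> 0"
    using tendsto_sigma_tail_le[OF r(2)] by simp
  then have "k_sparse K l" by (rule sigma_tail_le_zero_imp_k_sparse)
  moreover have "l \<in> solutions \<Phi> y"
    using closed_sequentially[OF solutions_closed _ r(2)] x_solution by blast
  ultimately show ?thesis using that r by blast
qed

lemma convergence_eps_zero: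
  assumes "eps \<longlonglongrightarrow> 0"
  obtains l where "x \<longlonglongrightarrow> l" "k_sparse K l" "l \<in> solutions \<Phi> y"
proof -
  obtain r l where r: "strict_mono r" "(\<lambda>n. x (Suc (r n))) \<longlonglongrightarrow> l"
    and l: "k_sparse K l" "l \<in> solutions \<Phi> y"
    using sparse_cluster_point[OF assms] by blast
  \<comment> \<open>Monotonicity gives \<open>F\<close> a limit along the full sequence, so its
    value may be identified on the subsequence alone.\<close>
  obtain L where L: "F \<longlonglongrightarrow> L" using F_convergent by (auto simp: convergent_def)
  have "(\<lambda>n. eps (Suc (r n))) \<longlonglongrightarrow> 0"
    using LIMSEQ_subseq_LIMSEQ[OF LIMSEQ_Suc[OF assms] r(1)] by (simp add: o_def)
  from tendsto_smooth_l1[OF r(2) this]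
  have "(\<lambda>n. F (r n)) \<longlonglongrightarrow> l1_norm l"
    by (simp add: F_def smooth_l1_def l1_norm_def)
  moreover have "(\<lambda>n. F (r n)) \<longlonglongrightarrow> L"
    using LIMSEQ_subseq_LIMSEQ[OF L r(1)] by (simp add: o_def)
  ultimately have "L = l1_norm l" by (metis LIMSEQ_unique)
  with L have "(\<lambda>n. (1 + \<gamma>) / (1 - \<gamma>) * (F n - l1_norm l)) \<longlonglongrightarrow> (1 + \<gamma>) / (1 - \<gamma>) * (l1_norm l - l1_norm l)"
    by (intro tendsto_intros) auto
  then have lim: "(\<lambda>n. (1 + \<gamma>) / (1 - \<gamma>) * (F n - l1_norm l)) \<longlonglongrightarrow> 0" by simp
  have "norm (x (Suc n) - l) \<le> (1 + \<gamma>) / (1 - \<gamma>) * (F n - l1_norm l)" for n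
  proof -
    have "(1 - \<gamma>) * norm (x (Suc n) - l) \<le> (1 - \<gamma>) * l1_norm (x (Suc n) - l)"
      using gamma norm_le_l1_norm by (intro mult_left_mono) auto
    also have "\<dots> \<le> (1 + \<gamma>) * (l1_norm (x (Suc n)) - l1_norm l)"
      using null_space_property_l1_dist[OF nsp gamma x_solution l(2,1)] .
    also have "\<dots> \<le> (1 + \<gamma>) * (F n - l1_norm l)"
      using gamma l1_norm_le_smooth_l1 unfolding F_def by (intro mult_left_mono) auto
    finally show ?thesis using gamma by (simp add: field_simps)
  qed
  then have "(\<lambda>n. x (Suc n) - l) \<longlonglongrightarrow> 0"
    by (intro Lim_null_comparison[OF _ lim]) auto
  then have "x \<longlonglongrightarrow> l" by (simp add: LIM_zero_iff LIMSEQ_imp_Suc)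
  with that l show ?thesis by blast
qed

section \<open>Smoothing parameter with a positive limit\<close>

lemma steps_tendsto_zero:
  assumes pos: "\<And>n. 0 < eps n"
  shows "(\<lambda>n. x (Suc (Suc n)) - x (Suc n)) \<longlonglongrightarrow> 0"
proof -
  obtain L where L: "F \<longlonglongrightarrow> L" using F_convergent by (auto simp: convergent_def)
  have "(\<lambda>n. sqrt (2 * F n * (F n - F (Suc n)))) \<longlonglongrightarrow> sqrt (2 * L * (L - L))"
    using L LIMSEQ_Suc[OF L] by (intro tendsto_intros)
  then have lim: "(\<lambda>n. sqrt (2 * F n * (F n - F (Suc n)))) \<longlonglongrightarrow> 0" by simp
  have "norm (x (Suc (Suc n)) - x (Suc n)) \<le> sqrt (2 * F n * (F n - F (Suc n)))" for n
  proof -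
    \<comment> \<open>Any single coordinate makes \<open>F n\<close> positive;
      \<open>undefined\<close> serves as an arbitrary index.\<close>
    have "0 < sqrt ((x (Suc n) $ undefined)\<^sup>2 + (eps (Suc n))\<^sup>2)"
      using pos[of "Suc n"] by (simp add: sum_power2_gt_zero_iff)
    then have "0 < F n"
      unfolding F_def using sqrt_le_smooth_l1 by (rule less_le_trans)
    moreover have "(norm (x (Suc (Suc n)) - x (Suc n)))\<^sup>2 / (2 * F n) \<le> F n - F (Suc n)"
      using F_decrease[of n] pos[of "Suc n"] by simp
    ultimately have "(norm (x (Suc (Suc n)) - x (Suc n)))\<^sup>2 \<le> 2 * F n * (F n - F (Suc n))"
      by (simp add: pos_divide_le_eq mult.commute)
    then show ?thesis by (rule real_le_rsqrt)
  qed
  then show ?thesis by (intro Lim_null_comparison[OF _ lim]) auto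
qed

text \<open>The orthogonality relation of each least squares step passes to the limit and becomes
  stationarity of \<open>smooth_l1 e\<close> at \<open>l\<close>.\<close>

lemma cluster_point_minimizes_smooth_l1:
  assumes "eps \<longlonglongrightarrow> e" "0 < e" and r: "strict_mono r" "(\<lambda>n. x (Suc (r n))) \<longlonglongrightarrow> l"
    and u: "u \<in> solutions \<Phi> y" "u \<noteq> l"
  shows "smooth_l1 e l < smooth_l1 e u"
proof (rule smooth_l1_less_of_stationary)
  have "e \<le> eps n" for n using eps_decseq assms(1) by (rule decseq_ge)
  then have pos: "0 < eps n" for n using assms(2) by (meson less_le_trans)
  have l: "l \<in> solutions \<Phi> y"
    using closed_sequentially[OF solutions_closed _ r(2)] x_solution by blast
  have ev: "(\<lambda>n. eps (Suc (r n))) \<longlonglongrightarrow> e"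
    using LIMSEQ_subseq_LIMSEQ[OF LIMSEQ_Suc[OF assms(1)] r(1)] by (simp add: o_def)
  have "(\<lambda>n. x (Suc (Suc (r n))) - x (Suc (r n))) \<longlonglongrightarrow> 0"
    using LIMSEQ_subseq_LIMSEQ[OF steps_tendsto_zero[OF pos] r(1)] by (simp add: o_def)
  from tendsto_add[OF this r(2)] have x2: "(\<lambda>n. x (Suc (Suc (r n)))) \<longlonglongrightarrow> l" by simp
  \<comment> \<open>Numerator and weight come from consecutive iterates; they share the limit
    \<open>l\<close> because the steps vanish.\<close>
  let ?g = "\<lambda>n. \<Sum>i\<in>UNIV. x (Suc (Suc (r n))) $ i * (u - l) $ i / sqrt ((x (Suc (r n)) $ i)\<^sup>2 + (eps (Suc (r n)))\<^sup>2)"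
  have "sqrt ((l $ i)\<^sup>2 + e\<^sup>2) \<noteq> 0" for i
    using assms(2) by (simp add: add_nonneg_eq_0_iff)
  then have "?g \<longlonglongrightarrow> (\<Sum>i\<in>UNIV. l $ i * (u - l) $ i / sqrt ((l $ i)\<^sup>2 + e\<^sup>2))"
    by (intro tendsto_intros x2 r ev)
  moreover have "?g n = 0" for n
  proof -
    have "\<Phi> *v (u - l) = 0"
      using u l by (simp add: solutions_def matrix_vector_mult_diff_distrib)
    then show ?thesis
      using weighted_norm_arg_min_orthogonal[OF _ step_arg_min, of "Suc (r n)" "u - l"] pos[of "Suc (r n)"]
      by (simp add: irls_weight_nth)
  qed
  ultimately show "(\<Sum>i\<in>UNIV. l $ i * (u - l) $ i / sqrt ((l $ i)\<^sup>2 + e\<^sup>2)) = 0"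
    by (simp add: LIMSEQ_const_iff)
qed (use assms in auto)

lemma convergence_eps_positive:
  assumes "eps \<longlonglongrightarrow> e" "0 < e"
  obtains l where "x \<longlonglongrightarrow> l" "\<And>u. u \<in> solutions \<Phi> y \<Longrightarrow> smooth_l1 e l \<le> smooth_l1 e u"
proof -
  note min = cluster_point_minimizes_smooth_l1[OF assms]
  obtain l r where r: "strict_mono r" "((\<lambda>n. x (Suc n)) \<circ> r) \<longlonglongrightarrow> l"
    using bounded_imp_convergent_subsequence[OF x_bounded] by blast
  have sol: "k \<in> solutions \<Phi> y" if "((\<lambda>n. x (Suc n)) \<circ> q) \<longlonglongrightarrow> k" for k q
    using closed_sequentially[OF solutions_closed _ that] x_solution by auto
  have "(\<lambda>n. x (Suc n)) \<longlonglongrightarrow> l"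
  proof (rule tendsto_if_unique_cluster_point[OF x_bounded])
    fix q k assume q: "strict_mono q" "((\<lambda>n. x (Suc n)) \<circ> q) \<longlonglongrightarrow> k"
    show "k = l"
      \<comment> \<open>Two distinct cluster points would each have strictly smaller
        \<open>smooth_l1 e\<close> than the other.\<close>
      using min[of r l k] min[of q k l] sol[OF r(2)] sol[OF q(2)] r q
      by (fastforce simp: o_def)
  qed
  then have "x \<longlonglongrightarrow> l" by (rule LIMSEQ_imp_Suc)
  moreover have "smooth_l1 e l \<le> smooth_l1 e u" if "u \<in> solutions \<Phi> y" for u
    using min[of r l u] r that by (cases "u = l") (auto simp: o_def)
  ultimately show ?thesis using that by blast
qed

section \<open>Excluding a positive limit\<close>

lemma eps_limit: obtains e where "eps \<longlonglongrightarrow> e" "0 \<le> e"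
  by (metis LIMSEQ_le_const decseq_convergent[OF eps_decseq] eps_nonneg)

text \<open>If the limit \<open>e\<close> were positive, comparing the limit point with \<open>xstar\<close> would bound its tail
  by \<open>\<eta> < 1\<close> times itself.\<close>

lemma sparse_solution_imp_eps_zero:
  assumes xs: "xstar \<in> solutions \<Phi> y" "k_sparse K xstar"
  shows "eps \<longlonglongrightarrow> 0"
proof (rule ccontr)
  assume "\<not> eps \<longlonglongrightarrow> 0"
  then obtain e where e: "eps \<longlonglongrightarrow> e" "0 < e"
    using eps_limit by (metis less_eq_real_def)
  obtain l where l: "x \<longlonglongrightarrow> l" "\<And>u. u \<in> solutions \<Phi> y \<Longrightarrow> smooth_l1 e l \<le> smooth_l1 e u"
    using convergence_eps_positive[OF e] by blast
  have sol: "l \<in> solutions \<Phi> y"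
    using closed_sequentially[OF solutions_closed _ LIMSEQ_Suc[OF l(1)]] x_solution by blast
  let ?T = "{i. xstar $ i \<noteq> 0}" and ?N = "real CARD('n)"
  let ?t = "\<Sum>i\<in>-?T. \<bar>l $ i\<bar>"
  have T: "card ?T \<le> K" "\<And>i. i \<notin> ?T \<Longrightarrow> xstar $ i = 0"
    using xs(2) by (auto simp: k_sparse_def)
  \<comment> \<open>The update rule bounds \<open>eps\<close> by the tail of each iterate; replacing
    that tail by the mass off the support of \<open>xstar\<close> gives a continuous expression that
    passes to the limit.\<close>
  have bound: "?N * e \<le> \<eta> * (1 - \<gamma>) * ?t"
  proof -
    have "?N * e \<le> \<eta> * (1 - \<gamma>) * sigma_tail K (x (Suc n))" for n
    proof -
      have "e \<le> eps (Suc n)" using eps_decseq e(1) by (rule decseq_ge)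
      also note eps_le_sigma_tail
      finally show ?thesis by (simp add: field_simps)
    qed
    moreover have "\<eta> * (1 - \<gamma>) * sigma_tail K (x (Suc n)) \<le> \<eta> * (1 - \<gamma>) * (\<Sum>i\<in>-?T. \<bar>x (Suc n) $ i\<bar>)" for n
      using gamma eta sigma_tail_le[OF T(1), of "x (Suc n)"] by (intro mult_left_mono) auto
    ultimately have "?N * e \<le> \<eta> * (1 - \<gamma>) * (\<Sum>i\<in>-?T. \<bar>x (Suc n) $ i\<bar>)" for n
      by (meson order_trans)
    moreover have "(\<lambda>n. \<eta> * (1 - \<gamma>) * (\<Sum>i\<in>-?T. \<bar>x (Suc n) $ i\<bar>)) \<longlonglongrightarrow> \<eta> * (1 - \<gamma>) * ?t"
      by (intro tendsto_intros LIMSEQ_Suc[OF l(1)])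
    ultimately show ?thesis by (intro LIMSEQ_le_const) auto
  qed
  \<comment> \<open>\<open>l\<close> minimizes the smoothed norm, and smoothing raises the \<ell>1
    norm of \<open>xstar\<close> by at most \<open>?N * e\<close>.\<close>
  have "l1_norm l \<le> l1_norm xstar + ?N * e"
    using l1_norm_le_smooth_l1[of l e] l(2)[OF xs(1)] smooth_l1_le_l1_norm[of e xstar] e(2) by linarith
  with null_space_property_gap(1)[OF nsp sol xs(1) T]
  have gap: "(1 - \<gamma>) * ?t \<le> ?N * e" by linarith
  \<comment> \<open>Positivity of \<open>e\<close> makes the tail nonzero, so that \<eta> < 1 yields
    a strict contradiction.\<close>
  have "0 < ?N * e" using e(2) by simp
  then have "0 < \<eta> * ((1 - \<gamma>) * ?t)" using bound by (simp add: mult.assoc)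
  then have "0 < (1 - \<gamma>) * ?t" using eta by (simp add: zero_less_mult_iff)
  then have "\<eta> * ((1 - \<gamma>) * ?t) < 1 * ((1 - \<gamma>) * ?t)" using eta by (intro mult_strict_right_mono)
  with gap bound show False by (simp add: mult.assoc)
qed

end

theorem theorem3p5:
  fixes \<Phi> :: "real ^ 'n ^ 'l" and y :: "real ^ 'l"
    and K :: nat and \<gamma> \<eta> :: real
    and x0 :: "real ^ 'n" and x :: "nat \<Rightarrow> real ^ 'n" and eps :: "nat \<Rightarrow> real"
  assumes "CARD('l) < CARD('n)"
    and "0 < K" and "0 < \<gamma>" and "\<gamma> < 1"
    and "null_space_property \<Phi> K \<gamma>"
    and "solutions \<Phi> y \<noteq> {}"
    and "0 < \<eta>" and "\<eta> < 1"
    and "modified_irls \<Phi> y K \<gamma> \<eta> x0 x eps"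
  shows "\<exists>xbar. x \<longlonglongrightarrow> xbar \<and>
      (eps \<longlonglongrightarrow> 0 \<longrightarrow>
         k_sparse K xbar \<and> is_unique_arg_min l1_norm (\<lambda>u. u \<in> solutions \<Phi> y) xbar) \<and>
      (\<forall>xstar \<in> solutions \<Phi> y. k_sparse K xstar \<longrightarrow>
         xbar = xstar \<and> is_unique_arg_min l1_norm (\<lambda>u. u \<in> solutions \<Phi> y) xstar \<and>
         eps \<longlonglongrightarrow> 0)"
proof -
  interpret irls \<Phi> y K \<gamma> \<eta> x0 x eps
    using assms by unfold_locales
  note unique = null_space_property_unique_arg_min[OF nsp gamma]
  show ?thesis
  proof (cases "eps \<longlonglongrightarrow> 0")
    case True
    then obtain l where l: "x \<longlonglongrightarrow> l" "k_sparse K l" "l \<in> solutions \<Phi> y"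
      using convergence_eps_zero by blast
    have "l = xstar" if "xstar \<in> solutions \<Phi> y" "k_sparse K xstar" for xstar
      using unique[OF l(3,2)] unique[OF that] unfolding is_unique_arg_min_def by blast
    with l unique True show ?thesis by blast
  next
    case False
    then obtain e where "eps \<longlonglongrightarrow> e" "0 < e"
      using eps_limit by (metis less_eq_real_def)
    then obtain l where "x \<longlonglongrightarrow> l" using convergence_eps_positive by blast
    \<comment> \<open>Both further claims are vacuous here: a sparse solution would force
      \<open>eps\<close> to 0.\<close>
    with False sparse_solution_imp_eps_zero show ?thesis by blast
  qed
qed

end
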